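(* Let $\omega$ be a positive integer divisible by $3$. For online call control with $\omega$ frequencies in any triangle-free cellular network, the algorithm CACO2 has competitive ratio at most $9/4$; that is, for every request sequence $\sigma$, $O(\sigma)\le \frac94\,\mathrm{CACO2}(\sigma)$.
   Context: Consider the infinite tiling of the plane by regular hexagons (cells), two cells being neighbors if they share an edge, with a fixed proper 3-coloring of the cells by colors $R,G,B$. A triangle-free cellular network is a set of cells, with the induced neighbor relation, containing no three mutually neighboring cells; each cell keeps its color. Consequently every cell has at most 3 neighbors in the network. Call control: there are $\omega$ frequencies $\{1,\dots,\omega\}$; a request sequence $\sigma$ is a finite sequence of cells of the network at which call requests arrive one by one; an online algorithm must immediately reject each request or accept it by assigning a frequency, such that two accepted calls in the same cell or in neighboring cells never get the same frequency; calls never terminate and frequencies are never changed. $A(\sigma)$ is the number of requests accepted by algorithm $A$, and $O(\sigma)$ the maximum number of requests of $\sigma$ that can be simultaneously accepted by a conflict-free assignment. A frequency is available for cell $C$ if it is used neither in $C$ nor in any neighbor of $C$. Define the cyclic successor $\mathrm{succ}(R)=G$, $\mathrm{succ}(G)=B$, $\mathrm{succ}(B)=R$, and let $F_R=\{1,\dots,\omega/3\}$, $F_G=\{\omega/3+1,\dots,2\omega/3\}$, $F_B=\{2\omega/3+1,\dots,\omega\}$. Assigning from a set "bottom-to-top" means assigning its smallest available frequency, "top-to-bottom" its largest available frequency. Algorithm CACO2, on a request at cell $C$ of color $X$: (1) if $C$ has no neighbors, assign any available frequency from $\{1,\dots,\omega\}$ (smallest first). (2) If $C$ has at least two neighbors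 and all its neighbors have the same color $Y$ (structure A), let $Z$ be the third color; assign from $F_X$ bottom-to-top if possible; otherwise assign from $F_Z$, bottom-to-top if $\mathrm{succ}(X)=Y$ and top-to-bottom otherwise, if possible; otherwise reject. (3) Otherwise (structure B: $C$ has exactly one neighbor, or two neighbors of different colors), let $Y=\mathrm{succ}(X)$; assign from $F_X$ bottom-to-top if possible; otherwise assign from $F_Y$ top-to-bottom if possible; otherwise reject. *)

theory Defs
  imports Complex_Main
begin

(* The hexagonal cells are given by axial coordinates: the cell (a, b) is centred at
   a * u + b * v, where u and v are the vectors between the centres of adjacent cells
   in two directions at an angle of 60 degrees. *)
type_synonym cell = "int \<times> int"

definition adjacent :: "cell \<Rightarrow> cell \<Rightarrow> bool" where
  "adjacent C D \<longleftrightarrow>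
     (fst D - fst C, snd D - snd C) \<in> {(1, 0), (- 1, 0), (0, 1), (0, - 1), (1, - 1), (- 1, 1)}"

datatype color = Red | Green | Blue

definition proper_coloring :: "(cell \<Rightarrow> color) \<Rightarrow> bool" where
  "proper_coloring col \<longleftrightarrow> (\<forall>C D. adjacent C D \<longrightarrow> col C \<noteq> col D)"

fun succ :: "color \<Rightarrow> color" where
  "succ Red = Green"
| "succ Green = Blue"
| "succ Blue = Red"

definition third_color :: "color \<Rightarrow> color \<Rightarrow> color" where
  "third_color X Y = (THE Z. Z \<noteq> X \<and> Z \<noteq> Y)"

definition triangle_free :: "cell set \<Rightarrow> bool" where
  "triangle_free N \<longleftrightarrow>
     \<not> (\<exists>C\<in>N. \<exists>D\<in>N. \<exists>E\<in>N. adjacent C D \<and> adjacent D E \<and> adjacent C E)"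

definition neighbors :: "cell set \<Rightarrow> cell \<Rightarrow> cell set" where
  "neighbors N C = {D \<in> N. adjacent C D}"

(* The answer to a request is Some f (accepted with frequency f) or None (rejected). *)
type_synonym answer = "nat option"

definition accepted :: "answer list \<Rightarrow> nat" where
  "accepted as = length (filter (\<lambda>a. a \<noteq> None) as)"

definition conflict_free :: "nat \<Rightarrow> cell list \<Rightarrow> answer list \<Rightarrow> bool" where
  "conflict_free \<omega> \<sigma> as \<longleftrightarrow>
     length as = length \<sigma> \<and>
     (\<forall>i < length \<sigma>. \<forall>f. as ! i = Some f \<longrightarrow> f \<in> {1..\<omega>}) \<and>
     (\<forall>i < length \<sigma>. \<forall>j < length \<sigma>.
        i \<noteq> j \<and> (\<sigma> ! i = \<sigma> ! j \<or> adjacent (\<sigma> ! i) (\<sigma> ! j)) \<and> as ! i \<noteq> None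
        \<longrightarrow> as ! i \<noteq> as ! j)"

definition offline_opt :: "nat \<Rightarrow> cell list \<Rightarrow> nat" where
  "offline_opt \<omega> \<sigma> = Max {accepted as | as. conflict_free \<omega> \<sigma> as}"

(* An online algorithm answers a request from the history of all earlier requests,
   together with the answers it gave to them. *)
type_synonym history = "(cell \<times> answer) list"
type_synonym online_algorithm = "history \<Rightarrow> cell \<Rightarrow> answer"

fun run_from :: "online_algorithm \<Rightarrow> history \<Rightarrow> cell list \<Rightarrow> answer list" where
  "run_from A h [] = []"
| "run_from A h (C # \<sigma>) = A h C # run_from A (h @ [(C, A h C)]) \<sigma>"

definition num_accepted :: "online_algorithm \<Rightarrow> cell list \<Rightarrow> nat" where
  "num_accepted A \<sigma> = accepted (run_from A [] \<sigma>)"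

definition used :: "history \<Rightarrow> cell \<Rightarrow> nat set" where
  "used h C = {f. (C, Some f) \<in> set h}"

definition available :: "cell set \<Rightarrow> nat \<Rightarrow> history \<Rightarrow> cell \<Rightarrow> nat set" where
  "available N \<omega> h C = {1..\<omega>} - used h C - (\<Union>D\<in>neighbors N C. used h D)"

fun freqs :: "nat \<Rightarrow> color \<Rightarrow> nat set" where
  "freqs \<omega> Red = {1..\<omega> div 3}"
| "freqs \<omega> Green = {\<omega> div 3 + 1..2 * \<omega> div 3}"
| "freqs \<omega> Blue = {2 * \<omega> div 3 + 1..\<omega>}"

definition bottom_to_top :: "nat set \<Rightarrow> answer" where
  "bottom_to_top S = (if S = {} then None else Some (Min S))"

definition top_to_bottom :: "nat set \<Rightarrow> answer" where
  "top_to_bottom S = (if S = {} then None else Some (Max S))"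

definition or_else :: "answer \<Rightarrow> answer \<Rightarrow> answer" where
  "or_else a b = (case a of Some f \<Rightarrow> Some f | None \<Rightarrow> b)"

definition structure_A :: "cell set \<Rightarrow> (cell \<Rightarrow> color) \<Rightarrow> cell \<Rightarrow> color \<Rightarrow> bool" where
  "structure_A N col C Y \<longleftrightarrow> 2 \<le> card (neighbors N C) \<and> (\<forall>D\<in>neighbors N C. col D = Y)"

definition caco2 :: "cell set \<Rightarrow> (cell \<Rightarrow> color) \<Rightarrow> nat \<Rightarrow> online_algorithm" where
  "caco2 N col \<omega> h C =
    (let X = col C; free = available N \<omega> h C in
     if neighbors N C = {} then bottom_to_top free
     else if \<exists>Y. structure_A N col C Y then
       (let Y = (THE Y. structure_A N col C Y); Z = third_color X Y in
        or_else (bottom_to_top (free \<inter> freqs \<omega> X))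
          (if succ X = Y then bottom_to_top (free \<inter> freqs \<omega> Z)
           else top_to_bottom (free \<inter> freqs \<omega> Z)))
     else
       or_else (bottom_to_top (free \<inter> freqs \<omega> X))
         (top_to_bottom (free \<inter> freqs \<omega> (succ X))))"

end

theory Submission
  imports Defs
begin

text \<open>
  In each block \<open>F\<^sub>W\<close> adjacent cells fill from opposite ends. Hence a block that is exhausted at
  \<open>C\<close> is filled by \<open>C\<close> together with a single neighbour, the blocker. With the block size normalised
  to \<open>1\<close>, let \<open>p\<close> and \<open>q\<close> be the shares of its own and of its second block that \<open>C\<close> uses,
  and let \<open>x \<le> 3\<close> be the share of the offline solution, so that \<open>4 / 9 * x \<le> 4 / 3\<close> has to be paid for
  out of accepted calls. If \<open>C\<close> rejects a call, both its blocks are exhausted; if it uses its second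
  block, its own one is exhausted.

  A blocker of the own block of \<open>C\<close> does so with its second block, and \<open>C\<close> is its only neighbour of
  that colour. It therefore lets \<open>C\<close> use the fraction \<open>min 1 (4 / 9 * x)\<close> of the blocking calls.
  This settles every \<open>C\<close> with \<open>x \<le> 9 / 4\<close>. A cell with larger \<open>x\<close> lacks at most \<open>1 / 3\<close>, and
  receives it from its second block and that block's blocker. All its neighbours have offline share
  below \<open>3 / 4\<close>, so that a blocker, which has at most three neighbours, can afford these payments.
\<close>

section \<open>Colours and the geometry of the hexagonal grid\<close>

lemma succ_neq [simp]: "succ X \<noteq> X" "X \<noteq> succ X"
  by (cases X; simp)+

lemma succ_succ_neq [simp]: "succ (succ X) \<noteq> X" "X \<noteq> succ (succ X)"
  by (cases X; simp)+

lemma succ_eq_iff [simp]: "succ X = succ Y \<longleftrightarrow> X = Y"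
  by (cases X; cases Y; simp)

lemma neq_color_cases: "X \<noteq> Y \<Longrightarrow> Y = succ X \<or> X = succ Y"
  by (cases X; cases Y; simp)

lemma third_color_eqI:
  assumes "X \<noteq> Y" "Z \<noteq> X" "Z \<noteq> Y"
  shows "third_color X Y = Z"
  unfolding third_color_def
proof (rule the_equality)
  show "W = Z" if "W \<noteq> X \<and> W \<noteq> Y" for W
    using assms that by (cases X; cases Y; cases Z; cases W; simp)
qed (use assms in auto)

lemma third_color_neq:
  assumes "X \<noteq> Y"
  shows "third_color X Y \<noteq> X" "third_color X Y \<noteq> Y"
proof -
  obtain Z where "Z \<noteq> X" "Z \<noteq> Y"
    by (metis color.distinct(1,3,5))
  with third_color_eqI[OF assms this] show "third_color X Y \<noteq> X" "third_color X Y \<noteq> Y"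
    by auto
qed

lemma adjacent_sym: "adjacent C D \<longleftrightarrow> adjacent D C"
proof -
  have "adjacent D C" if "adjacent C D" for C D
    using that unfolding adjacent_def insert_iff empty_iff prod.inject
    by (elim disjE conjE; simp)
  then show ?thesis
    by blast
qed

lemma in_neighbors_sym:
  "C \<in> N \<Longrightarrow> D \<in> neighbors N C \<Longrightarrow> C \<in> neighbors N D"
  unfolding neighbors_def using adjacent_sym by auto

lemma neighbors_mem: "D \<in> neighbors N C \<Longrightarrow> D \<in> N"
  unfolding neighbors_def by auto

lemma adjacent_pairs:
  "{D. adjacent (a, b) D} =
    {(a + 1, b), (a - 1, b), (a, b + 1), (a, b - 1), (a + 1, b - 1), (a - 1, b + 1)}"
proof (intro set_eqI)
  fix D
  have "x - a = c \<longleftrightarrow> x = a + c" for x a c :: int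
    by linarith
  then show "D \<in> {D. adjacent (a, b) D} \<longleftrightarrow>
      D \<in> {(a + 1, b), (a - 1, b), (a, b + 1), (a, b - 1), (a + 1, b - 1), (a - 1, b + 1)}"
    unfolding adjacent_def by (cases D) simp
qed

lemma finite_neighbors [simp]: "finite (neighbors N C)"
proof -
  have "neighbors N C \<subseteq> {D. adjacent C D}"
    unfolding neighbors_def by auto
  then show ?thesis
    using adjacent_pairs[of "fst C" "snd C"] by (auto intro: finite_subset)
qed

text \<open>Going round the hexagon of the six cells adjacent to \<open>(a, b)\<close>, the two colours different
  from \<open>col C\<close> alternate.\<close>

lemma alternating_colors:
  fixes a b :: int
  assumes "proper_coloring col"
  shows "col (a - 1, b + 1) = col (a + 1, b)"
    and "col (a, b - 1) = col (a + 1, b)"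
    and "col (a - 1, b) = col (a, b + 1)"
    and "col (a + 1, b - 1) = col (a, b + 1)"
    and "col (a + 1, b) \<noteq> col (a, b + 1)"
proof -
  have diff: "col (a, b) \<noteq> col (a + 1, b)" "col (a, b) \<noteq> col (a, b + 1)"
    "col (a, b) \<noteq> col (a - 1, b + 1)" "col (a, b) \<noteq> col (a - 1, b)"
    "col (a, b) \<noteq> col (a, b - 1)" "col (a, b) \<noteq> col (a + 1, b - 1)"
    "col (a + 1, b) \<noteq> col (a, b + 1)" "col (a, b + 1) \<noteq> col (a - 1, b + 1)"
    "col (a - 1, b + 1) \<noteq> col (a - 1, b)" "col (a - 1, b) \<noteq> col (a, b - 1)"
    "col (a, b - 1) \<noteq> col (a + 1, b - 1)" "col (a + 1, b - 1) \<noteq> col (a + 1, b)"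
    using assms unfolding proper_coloring_def adjacent_def by auto
  have eq: "U = W" if "U \<noteq> X" "V \<noteq> X" "W \<noteq> X" "U \<noteq> V" "V \<noteq> W" for U V W X :: color
    using that by (cases U; cases V; cases W; cases X; simp)
  show "col (a - 1, b + 1) = col (a + 1, b)"
    by (rule eq[of _ "col (a, b)" "col (a, b + 1)"]) (use diff in metis)+
  show "col (a, b - 1) = col (a + 1, b)"
    by (rule eq[of _ "col (a, b)" "col (a + 1, b - 1)"]) (use diff in metis)+
  show *: "col (a - 1, b) = col (a, b + 1)"
    by (rule eq[of _ "col (a, b)" "col (a - 1, b + 1)"]) (use diff in metis)+
  show "col (a + 1, b - 1) = col (a, b + 1)"
    by (rule eq[of _ "col (a, b)" "col (a + 1, b)"]) (use diff in metis)+
  show "col (a + 1, b) \<noteq> col (a, b + 1)"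
    by (rule diff)
qed

text \<open>On the hexagon around \<open>(a, b)\<close> the members of \<open>P\<close> and \<open>Q\<close> alternate, so each member of
  \<open>Q\<close> is adjacent to all of \<open>P\<close> but its antipode.\<close>

lemma ring_adjacent:
  fixes a b :: int
  assumes "P = {(a + 1, b), (a - 1, b + 1), (a, b - 1)}" "Q = {(a, b + 1), (a - 1, b), (a + 1, b - 1)}"
  shows "C \<in> P \<Longrightarrow> C' \<in> P \<Longrightarrow> C \<noteq> C' \<Longrightarrow> E \<in> Q \<Longrightarrow> adjacent C E \<or> adjacent C' E"
    and "C \<in> Q \<Longrightarrow> C' \<in> Q \<Longrightarrow> C \<noteq> C' \<Longrightarrow> E \<in> P \<Longrightarrow> adjacent C E \<or> adjacent C' E"
  unfolding assms insert_iff empty_iff simp_thms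
  by (elim disjE; simp add: adjacent_def)+

lemma neighbors_color_classes:
  assumes "proper_coloring col" "E \<in> neighbors N (a, b)"
  shows "E \<in> {(a + 1, b), (a - 1, b + 1), (a, b - 1)} \<and> col E = col (a + 1, b) \<or>
    E \<in> {(a, b + 1), (a - 1, b), (a + 1, b - 1)} \<and> col E = col (a, b + 1)"
proof -
  have "E \<in> {D. adjacent (a, b) D}"
    using assms(2) unfolding neighbors_def by simp
  then show ?thesis
    unfolding adjacent_pairs using alternating_colors(1-4)[OF assms(1), of a b] by auto
qed

text \<open>The six cells around \<open>D\<close> form two alternating triples, one per colour. A
  neighbour of the other colour would be adjacent to \<open>C\<close> or to \<open>C'\<close> and
  complete a triangle with it and \<open>D\<close>.\<close>

lemma neighbors_same_color:
  assumes col: "proper_coloring col" and tf: "triangle_free N" and "D \<in> N"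
    and C: "C \<in> neighbors N D" "C' \<in> neighbors N D" "C \<noteq> C'" "col C = col C'"
    and E: "E \<in> neighbors N D"
  shows "col E = col C"
proof -
  obtain a b where D: "D = (a, b)"
    by fastforce
  define P Q where PQ: "P = {(a + 1, b), (a - 1, b + 1), (a, b - 1)}"
    "Q = {(a, b + 1), (a - 1, b), (a + 1, b - 1)}"
  have mem: "X \<in> P \<and> col X = col (a + 1, b) \<or> X \<in> Q \<and> col X = col (a, b + 1)"
    if "X \<in> neighbors N D" for X
    using neighbors_color_classes[OF col] that unfolding D PQ by metis
  have no: "\<not> adjacent X Y" if "X \<in> neighbors N D" "Y \<in> neighbors N D" for X Y
    using that \<open>D \<in> N\<close> tf unfolding triangle_free_def neighbors_def by blast
  show ?thesis
    using mem[OF C(1)] mem[OF C(2)] mem[OF E] no[OF C(1) E] no[OF C(2) E] C(3,4)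
      alternating_colors(5)[OF col, of a b] ring_adjacent[OF PQ, of C C' E]
    by metis
qed

text \<open>If two neighbours share a colour, all neighbours lie in one alternating triple;
  otherwise their colours are pairwise distinct, and there are only three colours.\<close>

lemma card_neighbors_le_3:
  assumes col: "proper_coloring col" and tf: "triangle_free N" and "D \<in> N"
  shows "card (neighbors N D) \<le> 3"
proof (cases "\<exists>C \<in> neighbors N D. \<exists>C' \<in> neighbors N D. C \<noteq> C' \<and> col C = col C'")
  case True
  then obtain C C' where C: "C \<in> neighbors N D" "C' \<in> neighbors N D" "C \<noteq> C'" "col C = col C'"
    by blast
  obtain a b where D: "D = (a, b)"
    by fastforce
  have mem: "E \<in> {(a + 1, b), (a - 1, b + 1), (a, b - 1)} \<and> col C = col (a + 1, b) \<or>
      E \<in> {(a, b + 1), (a - 1, b), (a + 1, b - 1)} \<and> col C = col (a, b + 1)"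
    if "E \<in> neighbors N D" for E
    using neighbors_color_classes[OF col] neighbors_same_color[OF assms C that] that
    unfolding D by metis
  have "neighbors N D \<subseteq> {(a + 1, b), (a - 1, b + 1), (a, b - 1)} \<or>
      neighbors N D \<subseteq> {(a, b + 1), (a - 1, b), (a + 1, b - 1)}"
    using mem alternating_colors(5)[OF col, of a b] unfolding subset_iff by metis
  then obtain X Y Z where "neighbors N D \<subseteq> {X, Y, Z}"
    by blast
  then have "card (neighbors N D) \<le> card {X, Y, Z}"
    by (simp add: card_mono)
  also have "\<dots> \<le> 3"
    by (simp add: card_insert_if)
  finally show ?thesis .
next
  case False
  then have "card (neighbors N D) = card (col ` neighbors N D)"
    by (intro card_image[symmetric]) (auto simp: inj_on_def)
  also have "\<dots> \<le> card {Red, Green, Blue}"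
    by (rule card_mono) (use color.exhaust in auto)
  finally show ?thesis
    by simp
qed

subsection \<open>The secondary colour\<close>

text \<open>The colour of the second block of frequencies that CACO2 tries at a cell with neighbours.\<close>

definition second_color :: "cell set \<Rightarrow> (cell \<Rightarrow> color) \<Rightarrow> cell \<Rightarrow> color" where
  "second_color N col C =
    (if \<exists>Y. structure_A N col C Y then third_color (col C) (THE Y. structure_A N col C Y)
     else succ (col C))"

lemma structure_A_nonempty:
  assumes "structure_A N col C Y"
  obtains D where "D \<in> neighbors N C" "col D = Y"
proof -
  have "neighbors N C \<noteq> {}"
    using assms unfolding structure_A_def by auto
  with assms that show thesis
    unfolding structure_A_def by blast
qed

text \<open>The cardinality bound in \<open>structure_A\<close> supplies a neighbour, whose colour
  determines \<open>Y\<close>.\<close>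

lemma structure_A_the:
  assumes "structure_A N col C Y"
  shows "(THE Y. structure_A N col C Y) = Y"
proof -
  from assms obtain D where "D \<in> neighbors N C" "col D = Y"
    by (rule structure_A_nonempty)
  with assms show ?thesis
    unfolding structure_A_def by (intro the_equality) auto
qed

locale network =
  fixes N :: "cell set" and col :: "cell \<Rightarrow> color"
  assumes proper: "proper_coloring col" and triangle_free: "triangle_free N"
begin

abbreviation nb :: "cell \<Rightarrow> cell set" where "nb \<equiv> neighbors N"
abbreviation sec :: "cell \<Rightarrow> color" where "sec \<equiv> second_color N col"

lemma col_nb: "D \<in> nb C \<Longrightarrow> col D \<noteq> col C"
  using proper unfolding proper_coloring_def neighbors_def by fastforce

lemma second_color_A:
  assumes "structure_A N col C Y"
  shows "sec C = third_color (col C) Y" "sec C \<noteq> col C" "sec C \<noteq> Y"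
proof -
  show eq: "sec C = third_color (col C) Y"
    using assms structure_A_the[OF assms] unfolding second_color_def by auto
  from assms obtain D where "D \<in> nb C" "col D = Y"
    by (rule structure_A_nonempty)
  then have "col C \<noteq> Y"
    using col_nb by metis
  then show "sec C \<noteq> col C" "sec C \<noteq> Y"
    unfolding eq using third_color_neq by auto
qed

lemma second_color_B: "\<nexists>Y. structure_A N col C Y \<Longrightarrow> sec C = succ (col C)"
  unfolding second_color_def by (rule if_not_P)

lemma second_color_neq: "sec C \<noteq> col C"
  using second_color_A(2) second_color_B by (metis succ_neq(1))

text \<open>Two neighbours of one colour would force all neighbours into that colour, which is
  structure A.\<close>

lemma structure_B_inj:
  assumes "\<nexists>Y. structure_A N col C Y" "C \<in> N" "D \<in> nb C" "E \<in> nb C" "col D = col E"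
  shows "D = E"
proof (rule ccontr)
  assume "D \<noteq> E"
  then have "\<forall>E\<in>nb C. col E = col D"
    using neighbors_same_color[OF proper triangle_free \<open>C \<in> N\<close>] assms by blast
  moreover have "card {D, E} \<le> card (nb C)"
    using assms by (intro card_mono) auto
  ultimately have "structure_A N col C (col D)"
    using \<open>D \<noteq> E\<close> unfolding structure_A_def by simp
  with assms(1) show False
    by blast
qed

text \<open>In structure A the second colour is one that no neighbour has, so the coincidence leaves
  only structure B, where the second colour is the successor.\<close>

lemma second_color_eq_nb:
  assumes "D \<in> nb C" "sec C = col D"
  shows "\<nexists>Y. structure_A N col C Y" "col D = succ (col C)"
proof -
  show *: "\<nexists>Y. structure_A N col C Y"
    using assms second_color_A(3) unfolding structure_A_def by metis
  show "col D = succ (col C)"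
    using second_color_B[OF *] assms by simp
qed

text \<open>Neighbours sharing a block of frequencies fill it from opposite ends; a cell fills from the
  top exactly the block of the successor of its own colour.\<close>

lemma opposite_directions:
  assumes "C \<in> N" "D \<in> nb C" "W \<in> {col C, sec C}" "W \<in> {col D, sec D}"
  shows "succ (col C) = W \<longleftrightarrow> succ (col D) \<noteq> W"
proof -
  have "C \<in> nb D"
    using assms in_neighbors_sym by blast
  have neq: "col D \<noteq> col C"
    using col_nb assms by blast
  consider "W = col C" "W = sec D" | "W = col D" "W = sec C" | "W = sec C" "W = sec D"
    using assms neq by auto
  then show ?thesis
  proof cases
    case 1
    then show ?thesis
      using second_color_eq_nb(2)[OF \<open>C \<in> nb D\<close>] by simp
  next
    case 2
    then show ?thesis
      using second_color_eq_nb(2)[OF \<open>D \<in> nb C\<close>] by simp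
  next
    case 3
    \<comment> \<open>\<open>W\<close>, \<open>col C\<close> and \<open>col D\<close> are now three
      different colours, and \<open>W\<close> succeeds exactly one of the other two.\<close>
    then have "W \<noteq> col C" "W \<noteq> col D"
      using second_color_neq by metis+
    with neq show ?thesis
      by (cases W; cases "col C"; cases "col D"; simp)
  qed
qed

end

subsection \<open>Discharging\<close>

lemma sum_le_of_unique:
  fixes f :: "'a \<Rightarrow> real"
  assumes "\<And>x. x \<in> S \<Longrightarrow> f x \<le> B" "0 \<le> B" "\<And>x y. x \<in> S \<Longrightarrow> y \<in> S \<Longrightarrow> x = y"
  shows "sum f S \<le> B"
proof (cases "S = {}")
  case False
  then obtain x where "x \<in> S"
    by blast
  with assms(3) have "S = {x}"
    by blast
  with assms(1) show ?thesis
    by simp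
qed (use assms in simp)

lemma member_le_sum_nonneg:
  fixes f :: "'a \<Rightarrow> real"
  assumes "finite S" "x \<in> S" "\<And>y. y \<in> S \<Longrightarrow> 0 \<le> f y" "c \<le> f x"
  shows "c \<le> sum f S"
  using member_le_sum[of x S f] assms by fastforce

lemma sum_swap_neighbors:
  fixes f :: "cell \<Rightarrow> cell \<Rightarrow> real"
  assumes "finite S" "S \<subseteq> N"
  shows "(\<Sum>C\<in>S. \<Sum>D\<in>neighbors N C \<inter> S. f C D) = (\<Sum>C\<in>S. \<Sum>D\<in>neighbors N C \<inter> S. f D C)"
proof -
  have "(\<Sum>C\<in>S. \<Sum>D\<in>neighbors N C \<inter> S. f C D) = (\<Sum>C\<in>S. \<Sum>D\<in>{D \<in> S. adjacent C D}. f C D)"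
    using assms by (intro sum.cong) (auto simp: neighbors_def)
  also have "\<dots> = (\<Sum>D\<in>S. \<Sum>C\<in>{C \<in> S. adjacent C D}. f C D)"
    by (rule sum.swap_restrict) (use assms in auto)
  also have "\<dots> = (\<Sum>C\<in>S. \<Sum>D\<in>neighbors N C \<inter> S. f D C)"
    using assms by (intro sum.cong) (auto simp: neighbors_def adjacent_sym)
  finally show ?thesis .
qed

lemma discharge:
  fixes pay :: "cell \<Rightarrow> cell \<Rightarrow> real"
  assumes "finite S" "S \<subseteq> N"
    and nonneg: "\<And>C D. 0 \<le> pay C D"
    and outside: "\<And>C D. C \<notin> S \<Longrightarrow> pay C D = 0"
    and local_le: "\<And>C. C \<in> S \<Longrightarrow>
      need C + (\<Sum>D\<in>neighbors N C. pay C D) \<le> have C + (\<Sum>D\<in>neighbors N C. pay D C)"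
  shows "sum need S \<le> sum have S"
proof -
  have "need C + (\<Sum>D\<in>neighbors N C \<inter> S. pay C D)
      \<le> have C + (\<Sum>D\<in>neighbors N C \<inter> S. pay D C)" if "C \<in> S" for C
  proof -
    have "(\<Sum>D\<in>neighbors N C. pay D C) = (\<Sum>D\<in>neighbors N C \<inter> S. pay D C)"
      by (rule sum.mono_neutral_right) (use outside in auto)
    moreover have "(\<Sum>D\<in>neighbors N C \<inter> S. pay C D) \<le> (\<Sum>D\<in>neighbors N C. pay C D)"
      by (rule sum_mono2) (use nonneg in auto)
    ultimately show ?thesis
      using local_le[OF that] by linarith
  qed
  then have "(\<Sum>C\<in>S. need C + (\<Sum>D\<in>neighbors N C \<inter> S. pay C D))
      \<le> (\<Sum>C\<in>S. have C + (\<Sum>D\<in>neighbors N C \<inter> S. pay D C))"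
    by (rule sum_mono)
  then show ?thesis
    using sum_swap_neighbors[OF assms(1,2), of pay] by (simp add: sum.distrib)
qed

text \<open>Frequencies are counted in multiples of \<open>\<omega> / 3\<close>: \<open>usage C W\<close> is the share of the block of
  colour \<open>W\<close> used at \<open>C\<close>, and \<open>opt C\<close> the number of calls that an offline solution accepts
  at \<open>C\<close>.\<close>

locale final_state = network +
  fixes usage :: "cell \<Rightarrow> color \<Rightarrow> real" and opt :: "cell \<Rightarrow> real"
  assumes use_nonneg: "0 \<le> usage C W" and use_le_1: "usage C W \<le> 1"
    and use_eq_0: "\<lbrakk>C \<in> N; nb C \<noteq> {}; W \<noteq> col C; W \<noteq> sec C\<rbrakk> \<Longrightarrow> usage C W = 0"
    and opt_nonneg: "0 \<le> opt C"
    and opt_le_3: "opt C \<le> 3"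
    and opt_nb: "\<lbrakk>C \<in> N; D \<in> nb C\<rbrakk> \<Longrightarrow> opt C + opt D \<le> 3"
    and primary_full: "\<lbrakk>C \<in> N; nb C \<noteq> {}; usage C (sec C) > 0\<rbrakk> \<Longrightarrow>
      usage C (col C) \<ge> 1 \<or> (\<exists>D\<in>nb C. usage C (col C) + usage D (col C) \<ge> 1)"
    and opt_le_or_full: "\<lbrakk>C \<in> N; nb C \<noteq> {}\<rbrakk> \<Longrightarrow>
      opt C \<le> usage C (col C) + usage C (sec C) \<or>
      (\<forall>W\<in>{col C, sec C}. usage C W \<ge> 1 \<or> (\<exists>D\<in>nb C. usage C W + usage D W \<ge> 1))"
begin

section \<open>Payments between neighbouring cells\<close>

definition full :: "cell \<Rightarrow> color \<Rightarrow> bool" where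
  "full C W \<longleftrightarrow> usage C W \<ge> 1 \<or> (\<exists>D\<in>nb C. usage C W + usage D W \<ge> 1)"

definition demand :: "cell \<Rightarrow> real" where
  "demand C = min 1 (4 / 9 * opt C)"

text \<open>The first argument pays and the second receives, as in \<open>secondary_pay\<close> and
  \<open>pay\<close>. The payment is made even if the primary block of \<open>C\<close> is not
  exhausted.\<close>

definition primary_pay :: "cell \<Rightarrow> cell \<Rightarrow> real" where
  "primary_pay D C = (if sec D = col C then demand C * usage D (col C) else 0)"

text \<open>What a cell \<open>C\<close> with \<open>opt C > 9 / 4\<close> still lacks after spending \<open>1\<close> unit of its primary block is
  at most \<open>1 / 3\<close>. If \<open>D\<close> blocks the second block of \<open>C\<close>, then \<open>C\<close> itself uses at least
  \<open>1 - usage D (sec C)\<close> of it, of which it can spend \<open>2 / 3\<close>; the blocker pays the rest.\<close>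

definition secondary_pay :: "cell \<Rightarrow> cell \<Rightarrow> real" where
  "secondary_pay D C = max 0 (4 / 9 * opt C - 1 - 2 / 3 * (1 - usage D (sec C)))"

definition pay :: "cell \<Rightarrow> cell \<Rightarrow> real" where
  "pay D C = primary_pay D C + secondary_pay D C"

lemma demand_bounds: "0 \<le> demand C" "demand C \<le> 1" "demand C \<le> 4 / 9 * opt C"
  using opt_nonneg[of C] unfolding demand_def by auto

lemma pay_nonneg: "0 \<le> primary_pay D C" "0 \<le> secondary_pay D C" "0 \<le> pay D C"
  using demand_bounds use_nonneg unfolding pay_def primary_pay_def secondary_pay_def by auto

text \<open>Since \<open>opt C + opt D \<le> 3\<close>, the deficit \<open>4 / 9 * opt D - 1\<close>
  is at most \<open>1 / 3 - 4 / 9 * opt C\<close>: the more the payer itself needs, the less it can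
  owe.\<close>

lemma secondary_pay_le:
  assumes "C \<in> N" "D \<in> nb C" "usage C (sec D) \<le> b"
  shows "secondary_pay C D \<le> max 0 (1 / 3 - 4 / 9 * opt C - 2 / 3 * (1 - b))"
proof -
  have "4 / 9 * opt D - 1 - 2 / 3 * (1 - usage C (sec D)) \<le> 1 / 3 - 4 / 9 * opt C - 2 / 3 * (1 - b)"
    using opt_nb[OF assms(1,2)] assms(3) by argo
  then show ?thesis
    unfolding secondary_pay_def by linarith
qed

text \<open>This form is proportional to what the payer uses of the block, so it can be charged to
  those calls. It holds because \<open>1 / 3 - 4 / 9 * opt C\<close> never exceeds
  \<open>2 / 3\<close>.\<close>

lemma secondary_pay_le_mult:
  assumes "C \<in> N" "D \<in> nb C"
  shows "secondary_pay C D \<le> max 0 (1 / 3 - 4 / 9 * opt C) * usage C (sec D)"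
proof -
  define b where "b = usage C (sec D)"
  have b: "0 \<le> b" "b \<le> 1"
    using use_nonneg use_le_1 b_def by auto
  have "x - 2 / 3 * (1 - b) \<le> x * b" if "x \<le> 1 / 3" for x
  proof -
    have "(x - 2 / 3) * (1 - b) \<le> 0"
      using that b by (intro mult_nonpos_nonneg) auto
    then show ?thesis
      by (simp add: algebra_simps)
  qed
  from this[of "1 / 3 - 4 / 9 * opt C"]
  have "max 0 (1 / 3 - 4 / 9 * opt C - 2 / 3 * (1 - b)) \<le> max 0 (1 / 3 - 4 / 9 * opt C) * b"
    using b opt_nonneg[of C] by (auto simp: max_def mult_nonneg_nonneg)
  then show ?thesis
    using order_trans[OF secondary_pay_le[OF assms, of b]] unfolding b_def by blast
qed

text \<open>A blocker differs from \<open>C\<close> in colour, so it can use the block of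
  \<open>C\<close> only as its second block, and there it holds at least
  \<open>1 - usage C (col C)\<close>.\<close>

lemma primary_pay_received:
  assumes "C \<in> N" "full C (col C)"
  shows "demand C * (1 - usage C (col C)) \<le> (\<Sum>D\<in>nb C. primary_pay D C)"
proof (cases "usage C (col C) \<ge> 1")
  case True
  then have "demand C * (1 - usage C (col C)) \<le> 0"
    using demand_bounds by (intro mult_nonneg_nonpos) auto
  also have "\<dots> \<le> (\<Sum>D\<in>nb C. primary_pay D C)"
    by (intro sum_nonneg pay_nonneg)
  finally show ?thesis .
next
  case False
  then obtain D where D: "D \<in> nb C" "usage C (col C) + usage D (col C) \<ge> 1"
    using assms unfolding full_def by auto
  have "sec D = col C"
  proof (rule ccontr)
    assume "sec D \<noteq> col C"
    then have "usage D (col C) = 0"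
      using use_eq_0[of D "col C"] D(1) neighbors_mem in_neighbors_sym[OF \<open>C \<in> N\<close>]
        col_nb by (metis empty_iff)
    with D False show False
      by simp
  qed
  then have "demand C * (1 - usage C (col C)) \<le> primary_pay D C"
    using D demand_bounds unfolding primary_pay_def by (simp add: mult_left_mono)
  then show ?thesis
    using D by (intro member_le_sum_nonneg) (auto simp: pay_nonneg)
qed

lemma secondary_pay_received:
  assumes "C \<in> N" "full C (sec C)"
  shows "4 / 9 * opt C - 1 - 2 / 3 * usage C (sec C) \<le> (\<Sum>D\<in>nb C. secondary_pay D C)"
proof (cases "usage C (sec C) \<ge> 1")
  case True
  \<comment> \<open>As \<open>opt C \<le> 3\<close>, the deficit is at most \<open>1 / 3\<close>,
    less than the \<open>2 / 3\<close> that \<open>C\<close> can spend itself.\<close>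
  then have "4 / 9 * opt C - 1 - 2 / 3 * usage C (sec C) \<le> 0"
    using opt_le_3[of C] by simp
  also have "\<dots> \<le> (\<Sum>D\<in>nb C. secondary_pay D C)"
    by (intro sum_nonneg pay_nonneg)
  finally show ?thesis .
next
  case False
  then obtain D where D: "D \<in> nb C" "usage C (sec C) + usage D (sec C) \<ge> 1"
    using assms unfolding full_def by auto
  then have "4 / 9 * opt C - 1 - 2 / 3 * usage C (sec C) \<le> secondary_pay D C"
    unfolding secondary_pay_def by (intro max.coboundedI2) argo
  then show ?thesis
    using D by (intro member_le_sum_nonneg) (auto simp: pay_nonneg)
qed

text \<open>In structure A no neighbour has colour \<open>sec C\<close>, so no primary payment is
  due. What remains is at most three secondary payments.\<close>

lemma pay_A:
  assumes "C \<in> N" "structure_A N col C Y" and "usage C (col C) \<le> b" "usage C (sec C) \<le> b"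
  shows "(\<Sum>D\<in>nb C. pay C D) \<le> 3 * max 0 (1 / 3 - 4 / 9 * opt C - 2 / 3 * (1 - b))"
proof -
  let ?m = "max 0 (1 / 3 - 4 / 9 * opt C - 2 / 3 * (1 - b))"
  have "pay C D \<le> ?m" if D: "D \<in> nb C" for D
  proof -
    have "primary_pay C D = 0"
      using assms(2) second_color_A(3) D unfolding primary_pay_def structure_A_def by metis
    moreover have "usage C (sec D) \<le> b"
    proof (cases "sec D \<in> {col C, sec C}")
      case False
      then have "usage C (sec D) = 0"
        using use_eq_0[OF \<open>C \<in> N\<close>] D by blast
      then show ?thesis
        using assms(3) use_nonneg[of C "col C"] by simp
    qed (use assms(3,4) in auto)
    ultimately show ?thesis
      using secondary_pay_le[OF \<open>C \<in> N\<close> D] unfolding pay_def by simp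
  qed
  then have "(\<Sum>D\<in>nb C. pay C D) \<le> of_nat (card (nb C)) * ?m"
    by (rule sum_bounded_above)
  also have "\<dots> \<le> 3 * ?m"
    using card_neighbors_le_3[OF proper triangle_free \<open>C \<in> N\<close>] by (intro mult_right_mono) auto
  finally show ?thesis .
qed

text \<open>In structure B the neighbours have distinct colours. At most one has colour
  \<open>sec C\<close>; it receives only a primary payment, charged to the second block of
  \<open>C\<close>. At most one has the remaining colour; it receives only a secondary payment,
  charged to the primary block.\<close>

lemma pay_B:
  assumes "C \<in> N" and B: "\<nexists>Y. structure_A N col C Y"
    and demand: "\<And>D. D \<in> nb C \<Longrightarrow> demand D \<le> d" and "0 \<le> d"
  shows "(\<Sum>D\<in>nb C. pay C D) \<le>
    d * usage C (sec C) + max 0 (1 / 3 - 4 / 9 * opt C) * usage C (col C)"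
proof -
  let ?m = "max 0 (1 / 3 - 4 / 9 * opt C)"
  let ?S = "{D \<in> nb C. col D = sec C}" and ?P = "{D \<in> nb C. col D \<noteq> sec C}"
  note sec = second_color_B[OF B]
  have unique: "D = E" if "D \<in> nb C" "E \<in> nb C" "col D = col E" for D E
    using structure_B_inj[OF B \<open>C \<in> N\<close>] that by blast
  have pred: "succ (col D) = col C" if "D \<in> ?P" for D
    using that col_nb[of D C] neq_color_cases[of "col D" "col C"] sec by auto
  have "sum (pay C) ?S \<le> d * usage C (sec C)"
  proof (rule sum_le_of_unique)
    fix D
    assume D: "D \<in> ?S"
    then have "C \<in> nb D"
      using in_neighbors_sym[OF \<open>C \<in> N\<close>] by simp
    have "sec D \<noteq> col C"
      using second_color_eq_nb(2)[OF \<open>C \<in> nb D\<close>] D sec by auto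
    moreover have "sec D \<noteq> sec C"
      using D second_color_neq[of D] by auto
    ultimately have "usage C (sec D) = 0"
      using use_eq_0[OF \<open>C \<in> N\<close>] D by blast
    then have "secondary_pay C D \<le> 0"
      using secondary_pay_le_mult[OF \<open>C \<in> N\<close>, of D] D by simp
    moreover have "primary_pay C D \<le> d * usage C (sec C)"
      using demand[of D] D use_nonneg[of C "sec C"]
      unfolding primary_pay_def by (auto intro: mult_right_mono)
    ultimately show "pay C D \<le> d * usage C (sec C)"
      unfolding pay_def by simp
  qed (use unique \<open>0 \<le> d\<close> use_nonneg in auto)
  moreover have "sum (pay C) ?P \<le> ?m * usage C (col C)"
  proof (rule sum_le_of_unique)
    fix D
    assume D: "D \<in> ?P"
    have "usage C (sec D) \<le> usage C (col C)"
    proof (cases "sec D = col C \<or> usage C (sec D) = 0")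
      case True
      then show ?thesis
        using use_nonneg[of C "col C"] by auto
    next
      case False
      then have eq: "sec D = sec C"
        using use_eq_0[OF \<open>C \<in> N\<close>] D by blast
      with False have pos: "usage C (sec C) > 0"
        using use_nonneg[of C "sec C"] by simp
      \<comment> \<open>A neighbour using the primary block of \<open>C\<close> would have the
        colour preceding \<open>col C\<close>, hence be \<open>D\<close>, whose second colour is
        \<open>sec C\<close>. So nobody helps to fill that block, and by \<open>primary_full\<close>
        the cell \<open>C\<close> has filled it alone.\<close>
      have zero: "usage E (col C) = 0" if "E \<in> nb C" for E
      proof (rule ccontr)
        assume "usage E (col C) \<noteq> 0"
        moreover have E: "E \<in> N" "C \<in> nb E"
          using in_neighbors_sym[OF \<open>C \<in> N\<close> that] neighbors_mem[OF that] by auto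
        ultimately have "sec E = col C"
          using use_eq_0[of E "col C"] col_nb[OF that] by (metis empty_iff)
        then have "succ (col E) = col C"
          using second_color_eq_nb(2)[OF E(2)] by simp
        then have "E = D"
          using unique[OF that, of D] D pred[OF D] by (metis mem_Collect_eq succ_eq_iff)
        with \<open>sec E = col C\<close> False show False
          by simp
      qed
      have "usage C (col C) \<ge> 1"
        using primary_full[OF \<open>C \<in> N\<close> _ pos] D zero by fastforce
      then show ?thesis
        using use_le_1 order_trans by blast
    qed
    then have "?m * usage C (sec D) \<le> ?m * usage C (col C)"
      by (intro mult_left_mono) auto
    moreover have "primary_pay C D = 0"
      using D unfolding primary_pay_def by auto
    ultimately show "pay C D \<le> ?m * usage C (col C)"
      using secondary_pay_le_mult[OF \<open>C \<in> N\<close>, of D] D unfolding pay_def by simp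
  next
    fix D E
    assume "D \<in> ?P" "E \<in> ?P"
    then show "D = E"
      using unique pred by (metis (no_types, lifting) mem_Collect_eq succ_eq_iff)
  qed (use use_nonneg in auto)
  moreover have "(\<Sum>D\<in>nb C. pay C D) = sum (pay C) ?S + sum (pay C) ?P"
    by (subst sum.union_disjoint[symmetric]) (auto intro: sum.cong)
  ultimately show ?thesis
    by linarith
qed

lemma local_balance:
  assumes C: "C \<in> N" "nb C \<noteq> {}"
  shows "4 / 9 * opt C + (\<Sum>D\<in>nb C. pay C D) \<le>
    usage C (col C) + usage C (sec C) + (\<Sum>D\<in>nb C. pay D C)"
proof -
  define p q x where pqx: "p = usage C (col C)" "q = usage C (sec C)" "x = opt C"
  have pq: "0 \<le> p" "p \<le> 1" "0 \<le> q" "q \<le> 1" and x: "0 \<le> x" "x \<le> 3"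
    using use_nonneg use_le_1 opt_nonneg opt_le_3 pqx by auto
  have income: "(\<Sum>D\<in>nb C. pay D C) =
      (\<Sum>D\<in>nb C. primary_pay D C) + (\<Sum>D\<in>nb C. secondary_pay D C)"
    unfolding pay_def by (simp add: sum.distrib)
  have second_income: "0 \<le> (\<Sum>D\<in>nb C. secondary_pay D C)"
    by (intro sum_nonneg pay_nonneg)
  have out_A: "(\<Sum>D\<in>nb C. pay C D) \<le> 3 * max 0 (1 / 3 - 4 / 9 * x - 2 / 3 * (1 - max p q))"
    if "structure_A N col C Y" for Y
    using pay_A[OF C(1) that, of "max p q"] pqx by simp
  have out_B: "(\<Sum>D\<in>nb C. pay C D) \<le> d * q + max 0 (1 / 3 - 4 / 9 * x) * p"
    if "\<nexists>Y. structure_A N col C Y" "\<And>D. D \<in> nb C \<Longrightarrow> demand D \<le> d" "0 \<le> d" for d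
    using pay_B[OF C(1) that] pqx by simp
  have "4 / 9 * x + (\<Sum>D\<in>nb C. pay C D) \<le> p + q + (\<Sum>D\<in>nb C. pay D C)"
  \<comment> \<open>At \<open>9 / 4\<close> the value \<open>4 / 9 * x\<close> reaches the cap
    \<open>1\<close> of \<open>demand\<close>. Beyond it \<open>x\<close> also exceeds
    \<open>p + q\<close>, so both blocks are full.\<close>
  proof (cases "x > 9 / 4")
    case True
    then have full: "full C (col C)" "full C (sec C)"
      using opt_le_or_full[OF C] pq pqx unfolding full_def by auto
    have "demand C = 1"
      using True pqx unfolding demand_def by auto
    then have "1 - p \<le> (\<Sum>D\<in>nb C. primary_pay D C)"
      using primary_pay_received[OF C(1) full(1)] pqx by simp
    moreover have "4 / 9 * x - 1 - 2 / 3 * q \<le> (\<Sum>D\<in>nb C. secondary_pay D C)"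
      using secondary_pay_received[OF C(1) full(2)] pqx by simp
    \<comment> \<open>Together with \<open>p + q\<close>, the two incomes cover
      \<open>4 / 9 * x\<close> and leave \<open>1 / 3 * q\<close> to be paid out. Structure A pays
      nothing here; in structure B the demand of every neighbour is at most
      \<open>1 / 3\<close>.\<close>
    moreover have "(\<Sum>D\<in>nb C. pay C D) \<le> 1 / 3 * q"
    proof (cases "\<exists>Y. structure_A N col C Y")
      case A: True
      have "max 0 (1 / 3 - 4 / 9 * x - 2 / 3 * (1 - max p q)) = 0"
        using True pq by (auto simp: max_def)
      with A out_A pq show ?thesis
        by fastforce
    next
      case False
      have "max 0 (1 / 3 - 4 / 9 * x) = 0"
        using True by simp
      moreover have "demand D \<le> 1 / 3" if "D \<in> nb C" for D
        using demand_bounds(3)[of D] opt_nb[OF C(1) that] True pqx by linarith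
      ultimately show ?thesis
        using out_B[OF False, of "1 / 3"] by simp
    qed
    ultimately show ?thesis
      using income by argo
  next
    case False
    then have demand: "demand C = 4 / 9 * x"
      using pqx unfolding demand_def by simp
    have B: "(\<Sum>D\<in>nb C. pay C D) \<le> q + max 0 (1 / 3 - 4 / 9 * x) * p"
      if "\<nexists>Y. structure_A N col C Y"
      using out_B[OF that, of 1] demand_bounds by simp
    show ?thesis
    proof (cases "full C (col C)")
      case True
      have "4 / 9 * x * (1 - p) \<le> (\<Sum>D\<in>nb C. primary_pay D C)"
        using primary_pay_received[OF C(1) True] demand pqx by simp
      \<comment> \<open>The primary income covers \<open>4 / 9 * x * (1 - p)\<close>, so only the
        fraction \<open>p\<close> of the need is left.\<close>
      moreover have "(\<Sum>D\<in>nb C. pay C D) + 4 / 9 * x * p \<le> p + q"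
      proof -
        have xp: "4 / 9 * x * p \<le> 4 / 9 * x" "4 / 9 * x * p \<le> p"
          using False x pq by (intro mult_left_le mult_left_le_one_le; simp)+
        show ?thesis
        proof (cases "\<exists>Y. structure_A N col C Y")
          case True
          then obtain Y where "structure_A N col C Y" ..
          note out = out_A[OF this]
          have "0 \<le> max p q" "max p q \<le> 1" "max p q \<le> p + q"
            using pq by auto
          \<comment> \<open>If the maximum in \<open>out\<close> is positive, the bound is
            \<open>2 * max p q - 1 - 4 / 3 * x\<close>, at most
            \<open>max p q - 4 / 3 * x\<close>.\<close>
          with out xp pq x show ?thesis
            by (cases "0 \<le> 1 / 3 - 4 / 9 * x - 2 / 3 * (1 - max p q)") argo+
        next
          case False
          \<comment> \<open>The terms with factor \<open>p\<close> add up to at most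
            \<open>p * max (1 / 3) (4 / 9 * x)\<close>, which is at most \<open>p\<close>.\<close>
          from B[OF this] xp pq show ?thesis
            by (auto simp: max_def algebra_simps split: if_splits)
        qed
      qed
      ultimately show ?thesis
        using income second_income by (simp add: algebra_simps)
    next
      case not_full: False
      \<comment> \<open>A primary block that is not exhausted excludes both use of the second block
        and a shortfall against the offline solution. So \<open>x \<le> p\<close>, and no income is
        required.\<close>
      have "q = 0"
        using primary_full[OF C] not_full pq pqx unfolding full_def by force
      moreover have "x \<le> p + q"
        using opt_le_or_full[OF C] not_full pqx unfolding full_def by auto
      moreover have "0 \<le> (\<Sum>D\<in>nb C. pay D C)"
        by (intro sum_nonneg pay_nonneg)
      moreover have "4 / 9 * x + (\<Sum>D\<in>nb C. pay C D) \<le> p"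
      proof (cases "\<exists>Y. structure_A N col C Y")
        case True
        then obtain Y where "structure_A N col C Y" ..
        note out = out_A[OF this]
        have "max p q = p"
          using pq \<open>q = 0\<close> by simp
        with out pq x \<open>q = 0\<close> \<open>x \<le> p + q\<close> show ?thesis
          by (cases "0 \<le> 1 / 3 - 4 / 9 * x - 2 / 3 * (1 - p)") argo+
      next
        case False
        have "max 0 (1 / 3 - 4 / 9 * x) * p \<le> 1 / 3 * p"
          by (rule mult_right_mono) (use x pq in linarith)+
        with B[OF False] \<open>q = 0\<close> \<open>x \<le> p + q\<close> pq show ?thesis
          by linarith
      qed
      ultimately show ?thesis
        by simp
    qed
  qed
  then show ?thesis
    unfolding pqx .
qed

text \<open>\<open>served\<close> is a separate parameter because an isolated cell may use all three
  blocks, so its two shares need not account for all its accepted calls.\<close>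

theorem competitive:
  assumes "finite S" "S \<subseteq> N" and unused: "\<And>C W. C \<notin> S \<Longrightarrow> usage C W = 0"
    and served: "\<And>C. C \<in> S \<Longrightarrow> nb C \<noteq> {} \<Longrightarrow> served C = usage C (col C) + usage C (sec C)"
    and isolated: "\<And>C. C \<in> S \<Longrightarrow> nb C = {} \<Longrightarrow> opt C \<le> served C"
  shows "(\<Sum>C\<in>S. 4 / 9 * opt C) \<le> (\<Sum>C\<in>S. served C)"
proof (rule discharge[OF assms(1,2), of pay])
  fix C D
  show "0 \<le> pay C D"
    by (rule pay_nonneg)
  show "pay C D = 0" if "C \<notin> S"
    using unused[OF that] opt_le_3[of D]
    unfolding pay_def primary_pay_def secondary_pay_def by simp
next
  fix C
  assume "C \<in> S"
  show "4 / 9 * opt C + (\<Sum>D\<in>nb C. pay C D) \<le> served C + (\<Sum>D\<in>nb C. pay D C)"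
  proof (cases "nb C = {}")
    case True
    then show ?thesis
      using isolated[OF \<open>C \<in> S\<close>] opt_nonneg[of C] by simp
  next
    case False
    then show ?thesis
      using local_balance[of C] served \<open>C \<in> S\<close> \<open>S \<subseteq> N\<close> by auto
  qed
qed

end

subsection \<open>The run of CACO2\<close>

lemma finite_freqs [simp]: "finite (freqs \<omega> W)"
  by (cases W) auto

lemma card_freqs: "card (freqs (3 * k) W) = k"
  by (cases W) auto

lemma freqs_subset: "freqs (3 * k) W \<subseteq> {1..3 * k}"
  by (cases W) auto

lemma freqs_disjoint: "W \<noteq> W' \<Longrightarrow> freqs (3 * k) W \<inter> freqs (3 * k) W' = {}"
  by (cases W; cases W') auto

lemma used_append:
  "used (h @ [(C, a)]) D = used h D \<union> (if D = C then set_option a else {})"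
  unfolding used_def by auto

lemma available_append_subset: "available N \<omega> (h @ [(C, a)]) D \<subseteq> available N \<omega> h D"
  unfolding available_def used_append by auto

lemma finite_available [simp]: "finite (available N \<omega> h C)"
  unfolding available_def by auto

lemma bottom_to_top_simps:
  "bottom_to_top S = None \<longleftrightarrow> S = {}"
  "finite S \<Longrightarrow> bottom_to_top S = Some f \<longleftrightarrow> f \<in> S \<and> (\<forall>g\<in>S. f \<le> g)"
  unfolding bottom_to_top_def by (auto intro: Min_eqI Min_in)

lemma top_to_bottom_simps:
  "top_to_bottom S = None \<longleftrightarrow> S = {}"
  "finite S \<Longrightarrow> top_to_bottom S = Some f \<longleftrightarrow> f \<in> S \<and> (\<forall>g\<in>S. g \<le> f)"
  unfolding top_to_bottom_def by (auto intro: Max_eqI Max_in)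

lemma or_else_simps:
  "or_else a b = None \<longleftrightarrow> a = None \<and> b = None"
  "or_else a b = Some f \<longleftrightarrow> a = Some f \<or> a = None \<and> b = Some f"
  unfolding or_else_def by (auto split: option.splits)

section \<open>Filling order and invariant of the run\<close>

context network
begin

text \<open>One rule covers both structures: the second block is filled from the top exactly if its
  colour is \<open>succ (col C)\<close>. In structure A this matches the test
  \<open>succ X = Y\<close>, since exactly one of \<open>Y\<close> and \<open>sec C\<close> is the
  successor.\<close>

lemma caco2_eq:
  assumes "nb C \<noteq> {}"
  shows "caco2 N col \<omega> h C =
    or_else (bottom_to_top (available N \<omega> h C \<inter> freqs \<omega> (col C)))
      (if sec C = succ (col C) then top_to_bottom (available N \<omega> h C \<inter> freqs \<omega> (sec C))
       else bottom_to_top (available N \<omega> h C \<inter> freqs \<omega> (sec C)))"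
proof (cases "\<exists>Y. structure_A N col C Y")
  case True
  then obtain Y where A: "structure_A N col C Y" ..
  then obtain D where "D \<in> nb C" "col D = Y"
    by (rule structure_A_nonempty)
  then have "Y \<noteq> col C"
    using col_nb by blast
  then have "succ (col C) = Y \<longleftrightarrow> sec C \<noteq> succ (col C)"
    using second_color_A[OF A] by (cases Y; cases "col C"; cases "sec C"; simp)
  then show ?thesis
    using assms True second_color_A(1)[OF A] structure_A_the[OF A]
    unfolding caco2_def by (simp add: Let_def)
next
  case False
  show ?thesis
    unfolding caco2_def Let_def if_not_P[OF assms] if_not_P[OF False]
    using second_color_B[OF False] by simp
qed

text \<open>In the block of colour \<open>W\<close>, the cell \<open>C\<close> takes \<open>f\<close> no later than \<open>g\<close>.\<close>

definition before :: "cell \<Rightarrow> color \<Rightarrow> nat \<Rightarrow> nat \<Rightarrow> bool" where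
  "before C W f g \<longleftrightarrow> (if succ (col C) = W then g \<le> f else f \<le> g)"

lemma before_antisym: "before C W f g \<Longrightarrow> before C W g f \<Longrightarrow> f = g"
  unfolding before_def by (auto split: if_splits)

lemma before_first:
  assumes "finite S" "S \<noteq> {}"
  obtains f where "f \<in> S" "\<forall>g\<in>S. before C W f g"
proof (cases "succ (col C) = W")
  case True
  with assms that[of "Max S"] show thesis
    unfolding before_def by simp
next
  case False
  with assms that[of "Min S"] show thesis
    unfolding before_def by simp
qed

lemma before_opposite:
  assumes "C \<in> N" "D \<in> nb C" "W \<in> {col C, sec C}" "W \<in> {col D, sec D}"
  shows "before C W f g \<longleftrightarrow> before D W g f"
  using opposite_directions[OF assms] unfolding before_def by auto

lemma caco2_Some:
  assumes "nb C \<noteq> {}" "caco2 N col \<omega> h C = Some f"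
  obtains W where "W \<in> {col C, sec C}" "f \<in> available N \<omega> h C \<inter> freqs \<omega> W"
    and "\<forall>g \<in> available N \<omega> h C \<inter> freqs \<omega> W. before C W f g"
    and "W = sec C \<Longrightarrow> available N \<omega> h C \<inter> freqs \<omega> (col C) = {}"
proof (cases "available N \<omega> h C \<inter> freqs \<omega> (col C) = {}")
  case True
  with assms that[of "sec C"] show thesis
    unfolding caco2_eq[OF assms(1)] or_else_simps before_def
    by (auto simp: bottom_to_top_simps top_to_bottom_simps split: if_splits)
next
  case False
  with assms that[of "col C"] second_color_neq[of C] show thesis
    unfolding caco2_eq[OF assms(1)] or_else_simps before_def
    by (auto simp: bottom_to_top_simps)
qed

lemma caco2_None:
  assumes "nb C \<noteq> {}" "caco2 N col \<omega> h C = None" "W \<in> {col C, sec C}"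
  shows "available N \<omega> h C \<inter> freqs \<omega> W = {}"
  using assms(2,3) unfolding caco2_eq[OF assms(1)] or_else_simps
  by (auto simp: bottom_to_top_simps top_to_bottom_simps split: if_splits)

lemma caco2_available: "caco2 N col \<omega> h C = Some f \<Longrightarrow> f \<in> available N \<omega> h C"
proof (cases "nb C = {}")
  case True
  then show "caco2 N col \<omega> h C = Some f \<Longrightarrow> f \<in> available N \<omega> h C"
    unfolding caco2_def by (simp add: Let_def bottom_to_top_simps)
next
  case False
  then show "caco2 N col \<omega> h C = Some f \<Longrightarrow> f \<in> available N \<omega> h C"
    using caco2_Some by blast
qed

text \<open>The fifth clause makes the frequencies used at a cell an initial segment of each block
  with respect to \<open>before\<close>. The clauses about empty available sets persist because
  availability only shrinks.\<close>

definition invariant :: "nat \<Rightarrow> history \<Rightarrow> bool" where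
  "invariant k h \<longleftrightarrow>
    (\<forall>C. used h C \<subseteq> {1..3 * k}) \<and>
    (\<forall>C. length (filter (\<lambda>(D, a). D = C \<and> a \<noteq> None) h) = card (used h C)) \<and>
    (\<forall>C. nb C = {} \<longrightarrow> (C, None) \<in> set h \<longrightarrow> available N (3 * k) h C = {}) \<and>
    (\<forall>C. nb C \<noteq> {} \<longrightarrow> used h C \<subseteq> freqs (3 * k) (col C) \<union> freqs (3 * k) (sec C)) \<and>
    (\<forall>C W. nb C \<noteq> {} \<longrightarrow> C \<in> N \<longrightarrow>
      (\<forall>f \<in> used h C. \<forall>g \<in> freqs (3 * k) W. f \<in> freqs (3 * k) W \<longrightarrow> before C W g f \<longrightarrow>
        g \<in> used h C)) \<and>
    (\<forall>C. nb C \<noteq> {} \<longrightarrow> used h C \<inter> freqs (3 * k) (sec C) \<noteq> {} \<longrightarrow>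
      available N (3 * k) h C \<inter> freqs (3 * k) (col C) = {}) \<and>
    (\<forall>C. nb C \<noteq> {} \<longrightarrow> (C, None) \<in> set h \<longrightarrow>
      (\<forall>W \<in> {col C, sec C}. available N (3 * k) h C \<inter> freqs (3 * k) W = {}))"

lemma invariantD:
  assumes "invariant k h"
  shows "used h C \<subseteq> {1..3 * k}"
    and "length (filter (\<lambda>(D, a). D = C \<and> a \<noteq> None) h) = card (used h C)"
    and "nb C = {} \<Longrightarrow> (C, None) \<in> set h \<Longrightarrow> available N (3 * k) h C = {}"
    and "nb C \<noteq> {} \<Longrightarrow> used h C \<subseteq> freqs (3 * k) (col C) \<union> freqs (3 * k) (sec C)"
    and "\<lbrakk>nb C \<noteq> {}; C \<in> N; f \<in> used h C; f \<in> freqs (3 * k) W; g \<in> freqs (3 * k) W; before C W g f\<rbrakk>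
      \<Longrightarrow> g \<in> used h C"
    and "nb C \<noteq> {} \<Longrightarrow> used h C \<inter> freqs (3 * k) (sec C) \<noteq> {} \<Longrightarrow>
      available N (3 * k) h C \<inter> freqs (3 * k) (col C) = {}"
    and "nb C \<noteq> {} \<Longrightarrow> (C, None) \<in> set h \<Longrightarrow> W \<in> {col C, sec C} \<Longrightarrow>
      available N (3 * k) h C \<inter> freqs (3 * k) W = {}"
proof -
  note c1 = assms[unfolded invariant_def]
  note c2 = c1[THEN conjunct2]
  note c3 = c2[THEN conjunct2]
  note c4 = c3[THEN conjunct2]
  note c5 = c4[THEN conjunct2]
  note c6 = c5[THEN conjunct2]
  note c7 = c6[THEN conjunct2]
  show "used h C \<subseteq> {1..3 * k}"
    using c1[THEN conjunct1] by (rule spec)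
  show "length (filter (\<lambda>(D, a). D = C \<and> a \<noteq> None) h) = card (used h C)"
    using c2[THEN conjunct1] by (rule spec)
  show "nb C = {} \<Longrightarrow> (C, None) \<in> set h \<Longrightarrow> available N (3 * k) h C = {}"
    using c3[THEN conjunct1, THEN spec, of C] by blast
  show "nb C \<noteq> {} \<Longrightarrow> used h C \<subseteq> freqs (3 * k) (col C) \<union> freqs (3 * k) (sec C)"
    using c4[THEN conjunct1, THEN spec, of C] by blast
  show "\<lbrakk>nb C \<noteq> {}; C \<in> N; f \<in> used h C; f \<in> freqs (3 * k) W; g \<in> freqs (3 * k) W; before C W g f\<rbrakk>
      \<Longrightarrow> g \<in> used h C"
    using c5[THEN conjunct1, THEN spec, THEN spec, of C W] by blast
  show "nb C \<noteq> {} \<Longrightarrow> used h C \<inter> freqs (3 * k) (sec C) \<noteq> {} \<Longrightarrow>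
      available N (3 * k) h C \<inter> freqs (3 * k) (col C) = {}"
    using c6[THEN conjunct1, THEN spec, of C] by blast
  show "nb C \<noteq> {} \<Longrightarrow> (C, None) \<in> set h \<Longrightarrow> W \<in> {col C, sec C} \<Longrightarrow>
      available N (3 * k) h C \<inter> freqs (3 * k) W = {}"
    using c7[THEN spec, of C] by blast
qed

lemma used_block:
  assumes "invariant k h" "nb C \<noteq> {}" "f \<in> used h C" "f \<in> freqs (3 * k) W"
  shows "W \<in> {col C, sec C}"
  using invariantD(4)[OF assms(1,2)] assms(3,4) freqs_disjoint[of W _ k] by blast

text \<open>The frequencies of \<open>D\<close> form an initial segment in the order of
  \<open>D\<close>, which is the reverse of the order of \<open>C\<close>.\<close>

lemma used_by_neighbor:
  assumes inv: "invariant k h" and C: "C \<in> N" "D \<in> nb C" "W \<in> {col C, sec C}"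
    and g: "g \<in> used h D" "g \<in> freqs (3 * k) W" and f: "f \<in> freqs (3 * k) W" "before C W g f"
  shows "f \<in> used h D"
proof -
  have D: "D \<in> N" "nb D \<noteq> {}"
    using neighbors_mem[OF C(2)] in_neighbors_sym[OF C(1,2)] by auto
  then have "W \<in> {col D, sec D}"
    using used_block[OF inv] g by blast
  then have "before D W f g"
    using before_opposite[OF C] f by simp
  then show ?thesis
    using invariantD(5)[OF inv D(2,1) g f(1)] by blast
qed

text \<open>\<open>C\<close> takes the first available frequency. An earlier \<open>g\<close> that
  \<open>C\<close> does not use would have to be used by a neighbour, which by
  \<open>used_by_neighbor\<close> would then use \<open>f\<close> as well.\<close>

lemma segment_extend:
  assumes inv: "invariant k h" and C: "C \<in> N" "nb C \<noteq> {}" "caco2 N col (3 * k) h C = Some f"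
    and g: "f \<in> freqs (3 * k) V" "g \<in> freqs (3 * k) V" "before C V g f"
  shows "g \<in> insert f (used h C)"
proof -
  obtain W where W: "W \<in> {col C, sec C}" "f \<in> available N (3 * k) h C \<inter> freqs (3 * k) W"
    "\<forall>g \<in> available N (3 * k) h C \<inter> freqs (3 * k) W. before C W f g"
    using caco2_Some[OF C(2,3)] by metis
  then have "V = W"
    using freqs_disjoint[of V W k] g(1) by blast
  show ?thesis
  proof (cases "g \<in> available N (3 * k) h C")
    case True
    then show ?thesis
      using W g before_antisym \<open>V = W\<close> by blast
  next
    case False
    moreover have "g \<in> {1..3 * k}"
      using g freqs_subset by blast
    moreover have "g \<notin> used h D" if "D \<in> nb C" for D
    proof
      assume "g \<in> used h D"
      then have "f \<in> used h D"
        using used_by_neighbor[OF inv C(1) that] W(1) g \<open>V = W\<close> by blast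
      with W(2) that show False
        unfolding available_def by auto
    qed
    ultimately show ?thesis
      unfolding available_def by blast
  qed
qed

lemma invariant_Nil: "invariant k []"
  unfolding invariant_def used_def by simp

lemma invariant_step:
  assumes inv: "invariant k h" and "C \<in> N"
  shows "invariant k (h @ [(C, caco2 N col (3 * k) h C)])"
proof -
  define a where "a = caco2 N col (3 * k) h C"
  define h' where "h' = h @ [(C, a)]"
  have used: "used h' D = used h D \<union> (if D = C then set_option a else {})" for D
    unfolding h'_def by (rule used_append)
  have avail: "available N (3 * k) h' D \<subseteq> available N (3 * k) h D" for D
    unfolding h'_def by (rule available_append_subset)
  have set: "set h' = insert (C, a) (set h)"
    unfolding h'_def by simp
  have a_avail: "f \<in> available N (3 * k) h C" if "a = Some f" for f
    using that caco2_available a_def by simp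
  note I = invariantD[OF inv]
  have "invariant k h'"
    unfolding invariant_def
  proof (intro conjI allI impI ballI)
    show "used h' D \<subseteq> {1..3 * k}" for D
      using I(1)[of D] a_avail unfolding used available_def by (cases a) auto
    show "length (filter (\<lambda>(E, a). E = D \<and> a \<noteq> None) h') = card (used h' D)" for D
    proof (cases "D = C \<and> a \<noteq> None")
      case True
      then obtain f where f: "a = Some f"
        by auto
      have "finite (used h D)"
        using I(1)[of D] finite_subset by blast
      moreover have "f \<notin> used h D"
        using a_avail[OF f] True unfolding available_def by simp
      ultimately show ?thesis
        using I(2)[of D] True f used[of D] unfolding h'_def by simp
    next
      case False
      then show ?thesis
        using I(2)[of D] used[of D] unfolding h'_def by auto
    qed
    show "available N (3 * k) h' D = {}" if "nb D = {}" "(D, None) \<in> set h'" for D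
    proof (cases "(D, None) \<in> set h")
      case True
      then show ?thesis
        using I(3)[OF that(1)] avail by blast
    next
      case False
      then have "caco2 N col (3 * k) h D = None"
        using that(2) a_def unfolding set by auto
      then have "available N (3 * k) h D = {}"
        using that(1) unfolding caco2_def by (simp add: Let_def bottom_to_top_simps)
      then show ?thesis
        using avail by blast
    qed
    show "used h' D \<subseteq> freqs (3 * k) (col D) \<union> freqs (3 * k) (sec D)" if "nb D \<noteq> {}" for D
    proof -
      have "f \<in> freqs (3 * k) (col D) \<union> freqs (3 * k) (sec D)" if "D = C" "a = Some f" for f
      proof -
        have "caco2 N col (3 * k) h D = Some f"
          using that a_def by simp
        from caco2_Some[OF \<open>nb D \<noteq> {}\<close> this] show ?thesis
          by blast
      qed
      then show ?thesis
        using I(4)[OF that] unfolding used by (cases a) auto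
    qed
    show "g \<in> used h' D"
      if D: "nb D \<noteq> {}" "D \<in> N" and f: "f \<in> used h' D" "f \<in> freqs (3 * k) W"
        and g: "g \<in> freqs (3 * k) W" "before D W g f" for D W f g
    proof (cases "f \<in> used h D")
      case True
      then show ?thesis
        using I(5)[OF D True f(2) g] unfolding used by blast
    next
      case False
      then have "D = C" "a = Some f"
        using f(1) unfolding used by (auto split: if_splits)
      then show ?thesis
        using segment_extend[OF inv D(2,1) _ f(2) g] a_def unfolding used by simp
    qed
    show "available N (3 * k) h' D \<inter> freqs (3 * k) (col D) = {}"
      if D: "nb D \<noteq> {}" and nonempty: "used h' D \<inter> freqs (3 * k) (sec D) \<noteq> {}" for D
    proof (cases "used h D \<inter> freqs (3 * k) (sec D) = {}")
      case True
      then obtain f where f: "D = C" "a = Some f" "f \<in> freqs (3 * k) (sec D)"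
        using nonempty unfolding used by (auto split: if_splits)
      then have "caco2 N col (3 * k) h D = Some f"
        using a_def by simp
      from caco2_Some[OF D this] obtain W where W: "f \<in> freqs (3 * k) W"
        "W = sec D \<Longrightarrow> available N (3 * k) h D \<inter> freqs (3 * k) (col D) = {}"
        by blast
      then have "W = sec D"
        using freqs_disjoint[of W "sec D" k] f by blast
      with W avail show ?thesis
        by blast
    next
      case False
      then show ?thesis
        using I(6)[OF D] avail by blast
    qed
    show "available N (3 * k) h' D \<inter> freqs (3 * k) W = {}"
      if D: "nb D \<noteq> {}" "(D, None) \<in> set h'" "W \<in> {col D, sec D}" for D W
    proof (cases "(D, None) \<in> set h")
      case True
      then show ?thesis
        using I(7)[OF D(1) True D(3)] avail by blast
    next
      case False
      then have "caco2 N col (3 * k) h D = None"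
        using D(2) a_def unfolding set by auto
      then show ?thesis
        using caco2_None[OF D(1) _ D(3)] avail by blast
    qed
  qed
  then show ?thesis
    unfolding h'_def a_def .
qed

lemma invariant_run:
  assumes "invariant k h" "set \<sigma> \<subseteq> N"
  shows "invariant k (h @ zip \<sigma> (run_from (caco2 N col (3 * k)) h \<sigma>))"
  using assms
proof (induction \<sigma> arbitrary: h)
  case (Cons C \<sigma>)
  then show ?case
    using Cons.IH[OF invariant_step[OF Cons.prems(1), of C]] by simp
qed simp

text \<open>One neighbour suffices: whoever uses the first frequency missing at \<open>C\<close>
  also uses all later ones of the block, so it covers, together with \<open>C\<close>, the whole
  block.\<close>

lemma blocked:
  assumes inv: "invariant k h" and C: "C \<in> N" "W \<in> {col C, sec C}"
    and none: "available N (3 * k) h C \<inter> freqs (3 * k) W = {}"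
  shows "k \<le> card (used h C \<inter> freqs (3 * k) W) \<or>
    (\<exists>D\<in>nb C. k \<le> card (used h C \<inter> freqs (3 * k) W) + card (used h D \<inter> freqs (3 * k) W))"
proof (cases "freqs (3 * k) W \<subseteq> used h C")
  case True
  then have "used h C \<inter> freqs (3 * k) W = freqs (3 * k) W"
    by blast
  then show ?thesis
    by (simp add: card_freqs)
next
  case False
  then obtain f where f: "f \<in> freqs (3 * k) W - used h C"
    "\<forall>g \<in> freqs (3 * k) W - used h C. before C W f g"
    using before_first[of "freqs (3 * k) W - used h C" C W] by auto
  then obtain D where D: "D \<in> nb C" "f \<in> used h D"
    using none freqs_subset[of k W] unfolding available_def by blast
  have "g \<in> used h D" if "g \<in> freqs (3 * k) W" "g \<notin> used h C" for g
    using used_by_neighbor[OF inv C(1) D(1) C(2) D(2), of g] f that by blast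
  then have "freqs (3 * k) W \<subseteq> (used h C \<inter> freqs (3 * k) W) \<union> (used h D \<inter> freqs (3 * k) W)"
    by blast
  then have "k \<le> card ((used h C \<inter> freqs (3 * k) W) \<union> (used h D \<inter> freqs (3 * k) W))"
    using card_mono[of _ "freqs (3 * k) W"] by (metis card_freqs finite_Int finite_UnI finite_freqs)
  also have "\<dots> \<le> card (used h C \<inter> freqs (3 * k) W) + card (used h D \<inter> freqs (3 * k) W)"
    by (rule card_Un_le)
  finally show ?thesis
    using D(1) by blast
qed

end

subsection \<open>Counting accepted calls\<close>

text \<open>Positions in the request sequence are collected instead of frequencies, so the sets of
  different cells are disjoint even if frequencies are reused.\<close>

definition calls :: "cell list \<Rightarrow> answer list \<Rightarrow> cell \<Rightarrow> nat set" where
  "calls \<sigma> as C = {i. i < length \<sigma> \<and> \<sigma> ! i = C \<and> as ! i \<noteq> None}"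

lemma finite_calls [simp]: "finite (calls \<sigma> as C)"
  unfolding calls_def by simp

lemma accepted_eq_sum:
  assumes "length as = length \<sigma>"
  shows "accepted as = (\<Sum>C\<in>set \<sigma>. card (calls \<sigma> as C))"
proof -
  have "accepted as = card {i. i < length as \<and> as ! i \<noteq> None}"
    unfolding accepted_def by (simp add: length_filter_conv_card)
  also have "{i. i < length as \<and> as ! i \<noteq> None} = (\<Union>C\<in>set \<sigma>. calls \<sigma> as C)"
    using assms unfolding calls_def by auto
  also have "card \<dots> = (\<Sum>C\<in>set \<sigma>. card (calls \<sigma> as C))"
    by (rule card_UN_disjoint) (auto simp: calls_def)
  finally show ?thesis .
qed

lemma length_filter_zip_calls:
  assumes "length as = length \<sigma>"
  shows "length (filter (\<lambda>(D, a). D = C \<and> a \<noteq> None) (zip \<sigma> as)) = card (calls \<sigma> as C)"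
  using assms unfolding calls_def length_filter_conv_card
  by (intro arg_cong[where f = card]) auto

text \<open>The calls at two such cells have distinct frequencies. Allowing \<open>C = D\<close>
  yields the bound for a single cell too.\<close>

lemma card_calls_le:
  assumes "conflict_free \<omega> \<sigma> as" and CD: "C = D \<or> adjacent C D"
  shows "card (calls \<sigma> as C \<union> calls \<sigma> as D) \<le> \<omega>"
proof -
  have CD': "X = Y \<or> adjacent X Y" if "X \<in> {C, D}" "Y \<in> {C, D}" for X Y
    using CD that adjacent_sym by blast
  have len: "length as = length \<sigma>"
    and range: "\<And>i f. i < length \<sigma> \<Longrightarrow> as ! i = Some f \<Longrightarrow> f \<in> {1..\<omega>}"
    and distinct: "\<And>i j. \<lbrakk>i < length \<sigma>; j < length \<sigma>; i \<noteq> j; \<sigma> ! i = \<sigma> ! j \<or> adjacent (\<sigma> ! i) (\<sigma> ! j);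
      as ! i \<noteq> None\<rbrakk> \<Longrightarrow> as ! i \<noteq> as ! j"
    using assms(1) unfolding conflict_free_def by blast+
  have mem: "i < length \<sigma> \<and> \<sigma> ! i \<in> {C, D} \<and> as ! i \<noteq> None"
    if "i \<in> calls \<sigma> as C \<union> calls \<sigma> as D" for i
    using that unfolding calls_def by auto
  have "inj_on (\<lambda>i. the (as ! i)) (calls \<sigma> as C \<union> calls \<sigma> as D)"
  proof (rule inj_onI)
    fix i j
    assume ij: "i \<in> calls \<sigma> as C \<union> calls \<sigma> as D" "j \<in> calls \<sigma> as C \<union> calls \<sigma> as D"
      and "the (as ! i) = the (as ! j)"
    then have "as ! i = as ! j"
      using mem option.expand by blast
    then show "i = j"
      using distinct[of i j] mem[OF ij(1)] mem[OF ij(2)] CD' by blast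
  qed
  moreover have "(\<lambda>i. the (as ! i)) ` (calls \<sigma> as C \<union> calls \<sigma> as D) \<subseteq> {1..\<omega>}"
    using mem range by fastforce
  ultimately have "card (calls \<sigma> as C \<union> calls \<sigma> as D) \<le> card {1..\<omega>}"
    by (intro card_inj_on_le) auto
  then show ?thesis
    by simp
qed

lemma card_calls_adjacent:
  assumes "conflict_free \<omega> \<sigma> as" "adjacent C D"
  shows "card (calls \<sigma> as C) + card (calls \<sigma> as D) \<le> \<omega>"
proof -
  have "C \<noteq> D"
    using assms(2) unfolding adjacent_def by auto
  then have "calls \<sigma> as C \<inter> calls \<sigma> as D = {}"
    unfolding calls_def by auto
  then show ?thesis
    using card_calls_le[OF assms(1)] assms(2) by (metis card_Un_disjoint finite_calls)
qed

lemma card_calls_le_of_no_rejection: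
  assumes "length as = length \<sigma>" "(C, None) \<notin> set (zip \<sigma> as)"
  shows "card (calls \<sigma> bs C) \<le> card (calls \<sigma> as C)"
proof (rule card_mono)
  show "calls \<sigma> bs C \<subseteq> calls \<sigma> as C"
  proof
    fix i
    assume "i \<in> calls \<sigma> bs C"
    then have i: "i < length \<sigma>" "\<sigma> ! i = C"
      unfolding calls_def by auto
    then have "(C, as ! i) \<in> set (zip \<sigma> as)"
      using assms(1) by (auto simp: in_set_zip)
    with assms(2) have "as ! i \<noteq> None"
      by metis
    with i show "i \<in> calls \<sigma> as C"
      unfolding calls_def by simp
  qed
qed simp

section \<open>From the normalised balance to the competitive ratio\<close>

lemma length_run_from [simp]: "length (run_from A h \<sigma>) = length \<sigma>"
  by (induction \<sigma> arbitrary: h) auto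

lemma (in network) caco2_competitive:
  assumes "k > 0" and \<sigma>: "set \<sigma> \<subseteq> N" and cf: "conflict_free (3 * k) \<sigma> bs"
  shows "real (accepted bs) \<le> 9 / 4 * real (num_accepted (caco2 N col (3 * k)) \<sigma>)"
proof -
  define as where "as = run_from (caco2 N col (3 * k)) [] \<sigma>"
  define h where "h = zip \<sigma> as"
  define x where "x C W = card (used h C \<inter> freqs (3 * k) W)" for C W
  define usage where "usage C W = real (x C W) / real k" for C W
  define opt where "opt C = real (card (calls \<sigma> bs C)) / real k" for C
  have len: "length as = length \<sigma>"
    unfolding as_def by simp
  have inv: "invariant k h"
    using invariant_run[OF invariant_Nil \<sigma>] unfolding h_def as_def by simp
  have card_used: "card (used h C) = card (calls \<sigma> as C)" for C
    using invariantD(2)[OF inv, of C] length_filter_zip_calls[OF len, of C] unfolding h_def by simp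
  have divide: "real a / real k + real b / real k \<ge> 1 \<longleftrightarrow> k \<le> a + b" "real a / real k \<ge> 1 \<longleftrightarrow> k \<le> a"
    for a b
    using \<open>k > 0\<close> by (simp_all add: field_simps flip: of_nat_add)
  have split: "card (used h C) = x C (col C) + x C (sec C)" if "nb C \<noteq> {}" for C
  proof -
    have "used h C = (used h C \<inter> freqs (3 * k) (col C)) \<union> (used h C \<inter> freqs (3 * k) (sec C))"
      using invariantD(4)[OF inv that] by blast
    then show ?thesis
      using freqs_disjoint[of "col C" "sec C" k] second_color_neq[of C] unfolding x_def
      by (metis (no_types, lifting) card_Un_disjoint finite_Int finite_freqs inf_assoc
          inf_bot_right inf_left_commute)
  qed
  have full: "usage C W \<ge> 1 \<or> (\<exists>D\<in>nb C. usage C W + usage D W \<ge> 1)"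
    if "C \<in> N" "W \<in> {col C, sec C}" "available N (3 * k) h C \<inter> freqs (3 * k) W = {}" for C W
    using blocked[OF inv that] unfolding usage_def divide x_def .
  interpret final_state N col usage opt
  proof
    show "0 \<le> usage C W" "0 \<le> opt C" for C W
      unfolding usage_def opt_def by simp_all
    show "usage C W \<le> 1" for C W
    proof -
      have "x C W \<le> k"
        using card_mono[of "freqs (3 * k) W" "used h C \<inter> freqs (3 * k) W"]
        unfolding x_def by (simp add: card_freqs)
      then show ?thesis
        using \<open>k > 0\<close> unfolding usage_def by simp
    qed
    show "usage C W = 0" if "C \<in> N" "nb C \<noteq> {}" "W \<noteq> col C" "W \<noteq> sec C" for C W
    proof -
      have "used h C \<inter> freqs (3 * k) W = {}"
        using used_block[OF inv that(2)] that(3,4) by blast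
      then show ?thesis
        unfolding usage_def x_def by simp
    qed
    show "opt C \<le> 3" for C
      using card_calls_le[OF cf, of C C] \<open>k > 0\<close> unfolding opt_def by (simp add: field_simps)
    show "opt C + opt D \<le> 3" if "C \<in> N" "D \<in> nb C" for C D
      using card_calls_adjacent[OF cf, of C D] that \<open>k > 0\<close>
      unfolding opt_def neighbors_def by (simp add: field_simps flip: of_nat_add)
    show "usage C (col C) \<ge> 1 \<or> (\<exists>D\<in>nb C. usage C (col C) + usage D (col C) \<ge> 1)"
      if "C \<in> N" "nb C \<noteq> {}" "usage C (sec C) > 0" for C
    proof -
      have "used h C \<inter> freqs (3 * k) (sec C) \<noteq> {}"
        using that(3) unfolding usage_def x_def by auto
      then show ?thesis
        using full[of C "col C"] invariantD(6)[OF inv that(2)] that(1) by blast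
    qed
    show "opt C \<le> usage C (col C) + usage C (sec C) \<or>
        (\<forall>W\<in>{col C, sec C}. usage C W \<ge> 1 \<or> (\<exists>D\<in>nb C. usage C W + usage D W \<ge> 1))"
      if "C \<in> N" "nb C \<noteq> {}" for C
    proof (cases "(C, None) \<in> set h")
      case True
      then show ?thesis
        using full[OF that(1)] invariantD(7)[OF inv that(2) True] by blast
    next
      case False
      then have "card (calls \<sigma> bs C) \<le> card (used h C)"
        using card_calls_le_of_no_rejection[OF len] card_used unfolding h_def by metis
      then show ?thesis
        unfolding split[OF that(2)] opt_def usage_def
        by (simp add: divide_right_mono flip: add_divide_distrib of_nat_add)
    qed
  qed
  have "(\<Sum>C\<in>set \<sigma>. 4 / 9 * opt C) \<le> (\<Sum>C\<in>set \<sigma>. real (card (used h C)) / real k)"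
  proof (rule competitive)
    show "usage C W = 0" if "C \<notin> set \<sigma>" for C W
    proof -
      have "used h C = {}"
        using that unfolding used_def h_def by (auto dest: set_zip_leftD)
      then show ?thesis
        unfolding usage_def x_def by simp
    qed
    show "real (card (used h C)) / real k = usage C (col C) + usage C (sec C)"
      if "C \<in> set \<sigma>" "nb C \<noteq> {}" for C
      unfolding split[OF that(2)] usage_def by (simp add: add_divide_distrib)
    show "opt C \<le> real (card (used h C)) / real k" if "C \<in> set \<sigma>" "nb C = {}" for C
    proof -
      have "card (calls \<sigma> bs C) \<le> card (used h C)"
      proof (cases "(C, None) \<in> set h")
        case True
        \<comment> \<open>Without neighbours, an empty available set means that \<open>C\<close>
          itself uses every frequency.\<close>
        then have "used h C = {1..3 * k}"
          using invariantD(1,3)[OF inv, of C] that(2) unfolding available_def by auto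
        then show ?thesis
          using card_calls_le[OF cf, of C C] by simp
      next
        case False
        then show ?thesis
          using card_calls_le_of_no_rejection[OF len] card_used unfolding h_def by metis
      qed
      then show ?thesis
        unfolding opt_def by (simp add: divide_right_mono)
    qed
  qed (use \<sigma> in auto)
  then have "(4 / 9 * real (accepted bs)) / real k \<le> real (accepted as) / real k"
    using cf len unfolding opt_def card_used conflict_free_def
    by (simp add: accepted_eq_sum sum_divide_distrib sum_distrib_left)
  then show ?thesis
    using \<open>k > 0\<close> unfolding num_accepted_def as_def[symmetric] divide_le_cancel by simp
qed

theorem theorem2:
  fixes \<omega> :: nat and N :: "cell set" and col :: "cell \<Rightarrow> color" and \<sigma> :: "cell list"
  assumes "\<omega> > 0" and "3 dvd \<omega>"
    and "proper_coloring col"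
    and "triangle_free N"
    and "set \<sigma> \<subseteq> N"
  shows "real (offline_opt \<omega> \<sigma>) \<le> 9 / 4 * real (num_accepted (caco2 N col \<omega>) \<sigma>)"
proof -
  obtain k where k: "\<omega> = 3 * k" "k > 0"
    using assms(1,2) by auto
  interpret network N col
    using assms(3,4) by unfold_locales
  let ?S = "{accepted as | as. conflict_free \<omega> \<sigma> as}"
  have "accepted as \<le> length \<sigma>" if "conflict_free \<omega> \<sigma> as" for as
    using that unfolding accepted_def conflict_free_def by (metis length_filter_le)
  then have "finite ?S"
    by (intro finite_subset[of ?S "{..length \<sigma>}"]) auto
  \<comment> \<open>Rejecting everything is conflict-free, so \<open>Max\<close> is taken over a
    nonempty set and is attained.\<close>
  moreover have "conflict_free \<omega> \<sigma> (replicate (length \<sigma>) None)"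
    unfolding conflict_free_def by simp
  ultimately have "offline_opt \<omega> \<sigma> \<in> ?S"
    unfolding offline_opt_def by (intro Max_in) blast+
  then obtain as where "conflict_free \<omega> \<sigma> as" "offline_opt \<omega> \<sigma> = accepted as"
    by blast
  then show ?thesis
    using caco2_competitive[OF k(2) assms(5), of as] k(1) by simp
qed

end
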